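(* Let $A$ be a pseudo BCK-algebra and $\mu:A\to A$ a map. Then $(A,\mu)$ is a normal type II state pseudo BCK-algebra if and only if $(A,\mu)$ is a normal type I state pseudo BCK-algebra and ${\rm Ker}(\mu)$ is a commutative deductive system of $A$.
   Context: A pseudo BCK-algebra is an algebra $(A,\rightarrow,\rightsquigarrow,1)$ of type $(2,2,0)$ such that for all $x,y,z\in A$: $(x\rightarrow y)\rightsquigarrow[(y\rightarrow z)\rightsquigarrow(x\rightarrow z)]=1$; $(x\rightsquigarrow y)\rightarrow[(y\rightsquigarrow z)\rightarrow(x\rightsquigarrow z)]=1$; $1\rightarrow x=x$; $1\rightsquigarrow x=x$; $x\rightarrow 1=1$; and if $x\rightarrow y=1$ and $y\rightarrow x=1$ then $x=y$. The order is $x\le y$ iff $x\rightarrow y=1$ (iff $x\rightsquigarrow y=1$). A deductive system is a subset $D$ with $1\in D$ such that $x, x\rightarrow y\in D$ imply $y\in D$; it is normal if $x\rightarrow y\in D$ iff $x\rightsquigarrow y\in D$; it is commutative if $y\rightarrow x\in D$ implies $((x\rightarrow y)\rightsquigarrow y)\rightarrow x\in D$ and $y\rightsquigarrow x\in D$ implies $((x\rightsquigarrow y)\rightarrow y)\rightsquigarrow x\in D$. For $\mu:A\to A$ consider, for all $x,y\in A$: $(IS_1)$ $x\le y$ implies $\mu(x)\le\mu(y)$; $(IS_2)$ $\mu(x\rightarrow y)=\mu((x\rightarrow y)\rightsquigarrow y)\rightarrow\mu(y)$ and $\mu(x\rightsquigarrow y)=\mu((x\rightsquigarrow y)\rightarrow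 y)\rightsquigarrow\mu(y)$; $(IS_2')$ $\mu(x\rightarrow y)=\mu((y\rightarrow x)\rightsquigarrow x)\rightarrow\mu(y)$ and $\mu(x\rightsquigarrow y)=\mu((y\rightsquigarrow x)\rightarrow x)\rightsquigarrow\mu(y)$; $(IS_3)$ $\mu(\mu(x)\rightarrow\mu(y))=\mu(x)\rightarrow\mu(y)$ and $\mu(\mu(x)\rightsquigarrow\mu(y))=\mu(x)\rightsquigarrow\mu(y)$. $\mu$ is a type I state operator (and $(A,\mu)$ a type I state pseudo BCK-algebra) if it satisfies $(IS_1),(IS_2),(IS_3)$; type II if it satisfies $(IS_1),(IS_2'),(IS_3)$. ${\rm Ker}(\mu)=\{x\in A\mid \mu(x)=1\}$. A type I (type II) state operator is normal if ${\rm Ker}(\mu)$ is a normal deductive system. *)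

theory Defs
  imports "HOL-Algebra.Congruence"
begin

text \<open>Both arrows are printed in bold, since the plain arrow already denotes the
  set of functions between two sets.\<close>

record 'a pseudo_bck_signature = "'a partial_object" +
  arr :: "'a \<Rightarrow> 'a \<Rightarrow> 'a"  (infixr "\<^bold>\<rightarrow>\<index>" 65)
  sqarr :: "'a \<Rightarrow> 'a \<Rightarrow> 'a"  (infixr "\<^bold>\<leadsto>\<index>" 65)
  one :: 'a  ("\<one>\<index>")

locale pseudo_bck =
  fixes A :: "('a, 'm) pseudo_bck_signature_scheme" (structure)
  assumes arr_closed: "\<lbrakk>x \<in> carrier A; y \<in> carrier A\<rbrakk> \<Longrightarrow> x \<^bold>\<rightarrow> y \<in> carrier A"
    and sqarr_closed: "\<lbrakk>x \<in> carrier A; y \<in> carrier A\<rbrakk> \<Longrightarrow> x \<^bold>\<leadsto> y \<in> carrier A"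
    and one_closed: "\<one> \<in> carrier A"
    and arr_trans: "\<lbrakk>x \<in> carrier A; y \<in> carrier A; z \<in> carrier A\<rbrakk>
      \<Longrightarrow> (x \<^bold>\<rightarrow> y) \<^bold>\<leadsto> ((y \<^bold>\<rightarrow> z) \<^bold>\<leadsto> (x \<^bold>\<rightarrow> z)) = \<one>"
    and sqarr_trans: "\<lbrakk>x \<in> carrier A; y \<in> carrier A; z \<in> carrier A\<rbrakk>
      \<Longrightarrow> (x \<^bold>\<leadsto> y) \<^bold>\<rightarrow> ((y \<^bold>\<leadsto> z) \<^bold>\<rightarrow> (x \<^bold>\<leadsto> z)) = \<one>"
    and one_arr: "x \<in> carrier A \<Longrightarrow> \<one> \<^bold>\<rightarrow> x = x"
    and one_sqarr: "x \<in> carrier A \<Longrightarrow> \<one> \<^bold>\<leadsto> x = x"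
    and arr_one: "x \<in> carrier A \<Longrightarrow> x \<^bold>\<rightarrow> \<one> = \<one>"
    and arr_antisym: "\<lbrakk>x \<in> carrier A; y \<in> carrier A; x \<^bold>\<rightarrow> y = \<one>; y \<^bold>\<rightarrow> x = \<one>\<rbrakk> \<Longrightarrow> x = y"

definition bck_le :: "('a, 'm) pseudo_bck_signature_scheme \<Rightarrow> 'a \<Rightarrow> 'a \<Rightarrow> bool"
  (infix "\<preceq>\<index>" 50)
  where "x \<preceq>\<^bsub>A\<^esub> y \<longleftrightarrow> x \<^bold>\<rightarrow>\<^bsub>A\<^esub> y = \<one>\<^bsub>A\<^esub>"

locale deductive_system = pseudo_bck A
  for A :: "('a, 'm) pseudo_bck_signature_scheme" (structure) +
  fixes D :: "'a set"
  assumes ds_subset: "D \<subseteq> carrier A"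
    and ds_one: "\<one> \<in> D"
    and ds_mp: "\<lbrakk>x \<in> carrier A; y \<in> carrier A; x \<in> D; x \<^bold>\<rightarrow> y \<in> D\<rbrakk> \<Longrightarrow> y \<in> D"

locale normal_deductive_system = deductive_system A D
  for A :: "('a, 'm) pseudo_bck_signature_scheme" (structure) and D :: "'a set" +
  assumes ds_normal: "\<lbrakk>x \<in> carrier A; y \<in> carrier A\<rbrakk> \<Longrightarrow> x \<^bold>\<rightarrow> y \<in> D \<longleftrightarrow> x \<^bold>\<leadsto> y \<in> D"

locale commutative_deductive_system = deductive_system A D
  for A :: "('a, 'm) pseudo_bck_signature_scheme" (structure) and D :: "'a set" +
  assumes ds_comm_arr: "\<lbrakk>x \<in> carrier A; y \<in> carrier A; y \<^bold>\<rightarrow> x \<in> D\<rbrakk>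
      \<Longrightarrow> ((x \<^bold>\<rightarrow> y) \<^bold>\<leadsto> y) \<^bold>\<rightarrow> x \<in> D"
    and ds_comm_sqarr: "\<lbrakk>x \<in> carrier A; y \<in> carrier A; y \<^bold>\<leadsto> x \<in> D\<rbrakk>
      \<Longrightarrow> ((x \<^bold>\<leadsto> y) \<^bold>\<rightarrow> y) \<^bold>\<leadsto> x \<in> D"

definition Ker :: "('a, 'm) pseudo_bck_signature_scheme \<Rightarrow> ('a \<Rightarrow> 'a) \<Rightarrow> 'a set"
  where "Ker A \<mu> = {x \<in> carrier A. \<mu> x = \<one>\<^bsub>A\<^esub>}"

locale type_I_state_pseudo_bck = pseudo_bck A
  for A :: "('a, 'm) pseudo_bck_signature_scheme" (structure) +
  fixes \<mu> :: "'a \<Rightarrow> 'a"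
  assumes state_map: "\<mu> \<in> carrier A \<rightarrow> carrier A"
    and IS1: "\<lbrakk>x \<in> carrier A; y \<in> carrier A; x \<preceq> y\<rbrakk> \<Longrightarrow> \<mu> x \<preceq> \<mu> y"
    and IS2_arr: "\<lbrakk>x \<in> carrier A; y \<in> carrier A\<rbrakk>
      \<Longrightarrow> \<mu> (x \<^bold>\<rightarrow> y) = \<mu> ((x \<^bold>\<rightarrow> y) \<^bold>\<leadsto> y) \<^bold>\<rightarrow> \<mu> y"
    and IS2_sqarr: "\<lbrakk>x \<in> carrier A; y \<in> carrier A\<rbrakk>
      \<Longrightarrow> \<mu> (x \<^bold>\<leadsto> y) = \<mu> ((x \<^bold>\<leadsto> y) \<^bold>\<rightarrow> y) \<^bold>\<leadsto> \<mu> y"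
    and IS3_arr: "\<lbrakk>x \<in> carrier A; y \<in> carrier A\<rbrakk>
      \<Longrightarrow> \<mu> (\<mu> x \<^bold>\<rightarrow> \<mu> y) = \<mu> x \<^bold>\<rightarrow> \<mu> y"
    and IS3_sqarr: "\<lbrakk>x \<in> carrier A; y \<in> carrier A\<rbrakk>
      \<Longrightarrow> \<mu> (\<mu> x \<^bold>\<leadsto> \<mu> y) = \<mu> x \<^bold>\<leadsto> \<mu> y"

locale type_II_state_pseudo_bck = pseudo_bck A
  for A :: "('a, 'm) pseudo_bck_signature_scheme" (structure) +
  fixes \<mu> :: "'a \<Rightarrow> 'a"
  assumes state_map: "\<mu> \<in> carrier A \<rightarrow> carrier A"
    and IS1: "\<lbrakk>x \<in> carrier A; y \<in> carrier A; x \<preceq> y\<rbrakk> \<Longrightarrow> \<mu> x \<preceq> \<mu> y"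
    and IS2'_arr: "\<lbrakk>x \<in> carrier A; y \<in> carrier A\<rbrakk>
      \<Longrightarrow> \<mu> (x \<^bold>\<rightarrow> y) = \<mu> ((y \<^bold>\<rightarrow> x) \<^bold>\<leadsto> x) \<^bold>\<rightarrow> \<mu> y"
    and IS2'_sqarr: "\<lbrakk>x \<in> carrier A; y \<in> carrier A\<rbrakk>
      \<Longrightarrow> \<mu> (x \<^bold>\<leadsto> y) = \<mu> ((y \<^bold>\<leadsto> x) \<^bold>\<rightarrow> x) \<^bold>\<leadsto> \<mu> y"
    and IS3_arr: "\<lbrakk>x \<in> carrier A; y \<in> carrier A\<rbrakk>
      \<Longrightarrow> \<mu> (\<mu> x \<^bold>\<rightarrow> \<mu> y) = \<mu> x \<^bold>\<rightarrow> \<mu> y"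
    and IS3_sqarr: "\<lbrakk>x \<in> carrier A; y \<in> carrier A\<rbrakk>
      \<Longrightarrow> \<mu> (\<mu> x \<^bold>\<leadsto> \<mu> y) = \<mu> x \<^bold>\<leadsto> \<mu> y"

definition normal_type_I_state_pseudo_bck ::
    "('a, 'm) pseudo_bck_signature_scheme \<Rightarrow> ('a \<Rightarrow> 'a) \<Rightarrow> bool"
  where "normal_type_I_state_pseudo_bck A \<mu> \<longleftrightarrow>
    type_I_state_pseudo_bck A \<mu> \<and> normal_deductive_system A (Ker A \<mu>)"

definition normal_type_II_state_pseudo_bck ::
    "('a, 'm) pseudo_bck_signature_scheme \<Rightarrow> ('a \<Rightarrow> 'a) \<Rightarrow> bool"
  where "normal_type_II_state_pseudo_bck A \<mu> \<longleftrightarrow>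
    type_II_state_pseudo_bck A \<mu> \<and> normal_deductive_system A (Ker A \<mu>)"

end

theory Submission
  imports Defs
begin

text \<open>Both \<open>(x \<rightarrow> y) \<leadsto> y\<close> and \<open>(y \<rightarrow> x) \<leadsto> x\<close> are upper bounds of \<open>x\<close> and \<open>y\<close>.
  For \<open>y \<le> x\<close> the axiom \<open>(IS\<^sub>2')\<close> reads \<open>\<mu> (x \<rightarrow> y) = \<mu> x \<rightarrow> \<mu> y\<close>, and applying this to
  \<open>x \<rightarrow> y = ((x \<rightarrow> y) \<leadsto> y) \<rightarrow> y\<close> gives \<open>(IS\<^sub>2)\<close>; applying it to
  \<open>((x \<rightarrow> y) \<leadsto> y) \<rightarrow> x\<close> gives commutativity of the kernel.
  Conversely, commutativity of the kernel puts both arrows between the two upper bounds into the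
  kernel, so \<open>\<mu>\<close> identifies the bounds and \<open>(IS\<^sub>2)\<close> becomes \<open>(IS\<^sub>2')\<close>.\<close>

context pseudo_bck
begin

text \<open>The first transitivity axiom with 1 as its first argument. It is stated as an equation
  because \<open>\<preceq>\<close> is defined through \<open>\<rightarrow>\<close> and only
  \<open>le_iff_sqarr\<close> links it to \<open>\<leadsto>\<close>.\<close>

lemma sqarr_double_eq_one:
  assumes "x \<in> carrier A" "y \<in> carrier A"
  shows "x \<^bold>\<leadsto> ((x \<^bold>\<rightarrow> y) \<^bold>\<leadsto> y) = \<one>"
  using arr_trans[of \<one> x y] assms by (simp add: one_closed one_arr)

lemma le_sqarr_arr:
  assumes "x \<in> carrier A" "y \<in> carrier A"
  shows "x \<preceq> (x \<^bold>\<leadsto> y) \<^bold>\<rightarrow> y"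
  using sqarr_trans[of \<one> x y] assms by (simp add: one_closed one_sqarr bck_le_def)

text \<open>If \<open>x \<rightarrow> y = 1\<close>, then
  \<open>(x \<rightarrow> y) \<leadsto> y\<close> collapses to \<open>y\<close>, and
  \<open>sqarr_double_eq_one\<close> becomes \<open>x \<leadsto> y = 1\<close>. The converse is the
  mirror image through \<open>le_sqarr_arr\<close>.\<close>

lemma le_iff_sqarr:
  assumes "x \<in> carrier A" "y \<in> carrier A"
  shows "x \<preceq> y \<longleftrightarrow> x \<^bold>\<leadsto> y = \<one>"
  using sqarr_double_eq_one[OF assms] le_sqarr_arr[OF assms] assms
  by (auto simp: bck_le_def one_arr one_sqarr)

lemma le_arr_sqarr:
  assumes "x \<in> carrier A" "y \<in> carrier A"
  shows "x \<preceq> (x \<^bold>\<rightarrow> y) \<^bold>\<leadsto> y"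
  using sqarr_double_eq_one assms by (simp add: le_iff_sqarr arr_closed sqarr_closed)

lemma le_trans:
  assumes "x \<in> carrier A" "y \<in> carrier A" "z \<in> carrier A" "x \<preceq> y" "y \<preceq> z"
  shows "x \<preceq> z"
  using arr_trans[of x y z] assms by (simp add: bck_le_def one_sqarr arr_closed one_closed)

lemma le_antisym:
  assumes "x \<in> carrier A" "y \<in> carrier A" "x \<preceq> y" "y \<preceq> x"
  shows "x = y"
  using arr_antisym assms by (simp add: bck_le_def)

lemma arr_antimono:
  assumes "x \<in> carrier A" "y \<in> carrier A" "z \<in> carrier A" "x \<preceq> y"
  shows "y \<^bold>\<rightarrow> z \<preceq> x \<^bold>\<rightarrow> z"
  using arr_trans[of x y z] assms
  \<comment> \<open>The hypothesis is read with \<open>\<rightarrow>\<close> and the goal with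
    \<open>\<leadsto>\<close>: the first factor of the axiom is then 1, and what remains is the
    goal.\<close>
  by (simp add: le_iff_sqarr[of "y \<^bold>\<rightarrow> z"] one_sqarr arr_closed sqarr_closed bck_le_def[of _ x])

lemma sqarr_antimono:
  assumes "x \<in> carrier A" "y \<in> carrier A" "z \<in> carrier A" "x \<preceq> y"
  shows "y \<^bold>\<leadsto> z \<preceq> x \<^bold>\<leadsto> z"
  using sqarr_trans[of x y z] assms
  by (simp add: bck_le_def[of _ "y \<^bold>\<leadsto> z"] one_arr arr_closed sqarr_closed le_iff_sqarr[of x])

lemma le_one: "x \<in> carrier A \<Longrightarrow> x \<preceq> \<one>"
  by (simp add: bck_le_def arr_one)

text \<open>Antitonicity applied to \<open>x \<preceq> 1\<close>, since
  \<open>1 \<rightarrow> y\<close> is \<open>y\<close>.\<close>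

lemma le_arr:
  assumes "x \<in> carrier A" "y \<in> carrier A"
  shows "y \<preceq> x \<^bold>\<rightarrow> y"
  using arr_antimono[of x \<one> y] assms by (simp add: le_one one_closed one_arr)

lemma le_sqarr:
  assumes "x \<in> carrier A" "y \<in> carrier A"
  shows "y \<preceq> x \<^bold>\<leadsto> y"
  using sqarr_antimono[of x \<one> y] assms by (simp add: le_one one_closed one_sqarr)

text \<open>A Galois-type identity: one inequality is antitonicity applied to
  \<open>x \<preceq> (x \<rightarrow> y) \<leadsto> y\<close>, the other is
  \<open>le_sqarr_arr\<close> for the element \<open>x \<rightarrow> y\<close>.\<close>

lemma arr_sqarr_arr:
  assumes "x \<in> carrier A" "y \<in> carrier A"
  shows "((x \<^bold>\<rightarrow> y) \<^bold>\<leadsto> y) \<^bold>\<rightarrow> y = x \<^bold>\<rightarrow> y"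
  using assms by (intro le_antisym arr_antimono le_sqarr_arr le_arr_sqarr arr_closed sqarr_closed)

lemma sqarr_arr_sqarr:
  assumes "x \<in> carrier A" "y \<in> carrier A"
  shows "((x \<^bold>\<leadsto> y) \<^bold>\<rightarrow> y) \<^bold>\<leadsto> y = x \<^bold>\<leadsto> y"
  using assms by (intro le_antisym sqarr_antimono le_sqarr_arr le_arr_sqarr arr_closed sqarr_closed)

end

lemma (in deductive_system) ds_up:
  assumes "x \<in> D" "y \<in> carrier A" "x \<preceq> y"
  shows "y \<in> D"
  using assms ds_mp[of x y] ds_subset ds_one by (auto simp: bck_le_def)

context commutative_deductive_system
begin

text \<open>In both lemmas, commutativity is applied to \<open>y\<close> and the upper bound on the right.\<close>

lemma joins_arr:
  assumes [simp]: "x \<in> carrier A" "y \<in> carrier A"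
  shows "((x \<^bold>\<rightarrow> y) \<^bold>\<leadsto> y) \<^bold>\<rightarrow> ((y \<^bold>\<rightarrow> x) \<^bold>\<leadsto> x) \<in> D"
proof -
  let ?b = "(y \<^bold>\<rightarrow> x) \<^bold>\<leadsto> x"
  note [simp] = arr_closed sqarr_closed
  have "y \<^bold>\<rightarrow> ?b \<in> D"
    using le_arr_sqarr[of y x] ds_one by (simp add: bck_le_def)
  then have "((?b \<^bold>\<rightarrow> y) \<^bold>\<leadsto> y) \<^bold>\<rightarrow> ?b \<in> D"
    by (intro ds_comm_arr) auto
  \<comment> \<open>Here \<open>x \<preceq> ?b\<close>, and the passage to the double arrow over
    \<open>y\<close> reverses the order twice. Lowering the antecedent in the previous fact then
    raises the whole arrow, and \<open>D\<close> is closed upwards.\<close>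
  moreover have "(x \<^bold>\<rightarrow> y) \<^bold>\<leadsto> y \<preceq> (?b \<^bold>\<rightarrow> y) \<^bold>\<leadsto> y"
    by (intro sqarr_antimono arr_antimono le_sqarr) auto
  ultimately show ?thesis
    by (rule_tac ds_up[OF _ _ arr_antimono]) auto
qed

lemma joins_sqarr:
  assumes [simp]: "x \<in> carrier A" "y \<in> carrier A"
  shows "((x \<^bold>\<leadsto> y) \<^bold>\<rightarrow> y) \<^bold>\<leadsto> ((y \<^bold>\<leadsto> x) \<^bold>\<rightarrow> x) \<in> D"
proof -
  let ?b = "(y \<^bold>\<leadsto> x) \<^bold>\<rightarrow> x"
  note [simp] = arr_closed sqarr_closed
  have "y \<^bold>\<leadsto> ?b \<in> D"
    using le_sqarr_arr[of y x] ds_one by (simp add: le_iff_sqarr)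
  then have "((?b \<^bold>\<leadsto> y) \<^bold>\<rightarrow> y) \<^bold>\<leadsto> ?b \<in> D"
    by (intro ds_comm_sqarr) auto
  moreover have "(x \<^bold>\<leadsto> y) \<^bold>\<rightarrow> y \<preceq> (?b \<^bold>\<leadsto> y) \<^bold>\<rightarrow> y"
    by (intro sqarr_antimono arr_antimono le_arr) auto
  ultimately show ?thesis
    by (rule_tac ds_up[OF _ _ sqarr_antimono]) auto
qed

end

context type_I_state_pseudo_bck
begin

lemma state_closed: "x \<in> carrier A \<Longrightarrow> \<mu> x \<in> carrier A"
  using state_map by auto

text \<open>Monotonicity gives
  \<open>\<mu> x \<preceq> \<mu> ((x \<rightarrow> y) \<leadsto> y)\<close>; when
  \<open>\<mu> (x \<rightarrow> y) = 1\<close>, \<open>IS2_arr\<close> says precisely that the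
  latter lies below \<open>\<mu> y\<close>.\<close>

lemma state_le_if_arr_mem_Ker:
  assumes [simp]: "x \<in> carrier A" "y \<in> carrier A" and "x \<^bold>\<rightarrow> y \<in> Ker A \<mu>"
  shows "\<mu> x \<preceq> \<mu> y"
proof (rule le_trans)
  show "\<mu> x \<preceq> \<mu> ((x \<^bold>\<rightarrow> y) \<^bold>\<leadsto> y)"
    by (intro IS1 le_arr_sqarr) (simp_all add: arr_closed sqarr_closed)
  show "\<mu> ((x \<^bold>\<rightarrow> y) \<^bold>\<leadsto> y) \<preceq> \<mu> y"
    using assms IS2_arr[of x y] by (simp add: Ker_def bck_le_def)
qed (simp_all add: state_closed arr_closed sqarr_closed)

lemma state_le_if_sqarr_mem_Ker:
  assumes [simp]: "x \<in> carrier A" "y \<in> carrier A" and "x \<^bold>\<leadsto> y \<in> Ker A \<mu>"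
  shows "\<mu> x \<preceq> \<mu> y"
proof (rule le_trans)
  show "\<mu> x \<preceq> \<mu> ((x \<^bold>\<leadsto> y) \<^bold>\<rightarrow> y)"
    by (intro IS1 le_sqarr_arr) (simp_all add: arr_closed sqarr_closed)
  show "\<mu> ((x \<^bold>\<leadsto> y) \<^bold>\<rightarrow> y) \<preceq> \<mu> y"
    using assms IS2_sqarr[of x y]
    by (simp add: Ker_def le_iff_sqarr state_closed arr_closed sqarr_closed)
qed (simp_all add: state_closed arr_closed sqarr_closed)

lemma type_II_if_commutative_Ker:
  assumes "commutative_deductive_system A (Ker A \<mu>)"
  shows "type_II_state_pseudo_bck A \<mu>"
proof -
  interpret K: commutative_deductive_system A "Ker A \<mu>" by fact
  \<comment> \<open>Exchanging \<open>x\<close> and \<open>y\<close> in \<open>joins_arr\<close>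
    yields the reverse inequality.\<close>
  have arr: "\<mu> ((x \<^bold>\<rightarrow> y) \<^bold>\<leadsto> y) = \<mu> ((y \<^bold>\<rightarrow> x) \<^bold>\<leadsto> x)"
    if "x \<in> carrier A" "y \<in> carrier A" for x y
    using that by (intro le_antisym state_le_if_arr_mem_Ker K.joins_arr)
      (simp_all add: state_closed arr_closed sqarr_closed)
  have sqarr: "\<mu> ((x \<^bold>\<leadsto> y) \<^bold>\<rightarrow> y) = \<mu> ((y \<^bold>\<leadsto> x) \<^bold>\<rightarrow> x)"
    if "x \<in> carrier A" "y \<in> carrier A" for x y
    using that by (intro le_antisym state_le_if_sqarr_mem_Ker K.joins_sqarr)
      (simp_all add: state_closed arr_closed sqarr_closed)
  show ?thesis
    by unfold_locales
      (simp_all add: state_map IS1 IS3_arr IS3_sqarr IS2_arr IS2_sqarr arr sqarr)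
qed

end

context type_II_state_pseudo_bck
begin

text \<open>Since \<open>y \<rightarrow> x = 1\<close>, the upper bound
  \<open>(y \<rightarrow> x) \<leadsto> x\<close> in \<open>IS2'_arr\<close> is
  \<open>x\<close>.\<close>

lemma state_arr:
  assumes "x \<in> carrier A" "y \<in> carrier A" "y \<preceq> x"
  shows "\<mu> (x \<^bold>\<rightarrow> y) = \<mu> x \<^bold>\<rightarrow> \<mu> y"
  using IS2'_arr[of x y] assms by (simp add: bck_le_def one_sqarr)

lemma state_sqarr:
  assumes "x \<in> carrier A" "y \<in> carrier A" "y \<preceq> x"
  shows "\<mu> (x \<^bold>\<leadsto> y) = \<mu> x \<^bold>\<leadsto> \<mu> y"
  using IS2'_sqarr[of x y] assms by (simp add: le_iff_sqarr one_arr)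

lemma type_I: "type_I_state_pseudo_bck A \<mu>"
proof unfold_locales
  fix x y assume [simp]: "x \<in> carrier A" "y \<in> carrier A"
  note [simp] = arr_closed sqarr_closed
  show "\<mu> (x \<^bold>\<rightarrow> y) = \<mu> ((x \<^bold>\<rightarrow> y) \<^bold>\<leadsto> y) \<^bold>\<rightarrow> \<mu> y"
    using state_arr[of "(x \<^bold>\<rightarrow> y) \<^bold>\<leadsto> y" y] by (simp add: le_sqarr arr_sqarr_arr)
  show "\<mu> (x \<^bold>\<leadsto> y) = \<mu> ((x \<^bold>\<leadsto> y) \<^bold>\<rightarrow> y) \<^bold>\<leadsto> \<mu> y"
    using state_sqarr[of "(x \<^bold>\<leadsto> y) \<^bold>\<rightarrow> y" y] by (simp add: le_arr sqarr_arr_sqarr)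
qed (simp_all add: state_map IS1 IS3_arr IS3_sqarr)

lemma commutative_Ker:
  assumes "deductive_system A (Ker A \<mu>)"
  shows "commutative_deductive_system A (Ker A \<mu>)"
proof -
  interpret K: deductive_system A "Ker A \<mu>" by fact
  note [simp] = arr_closed sqarr_closed
  show ?thesis
  proof unfold_locales
    fix x y assume [simp]: "x \<in> carrier A" "y \<in> carrier A"
    \<comment> \<open>As \<open>x\<close> lies below
      \<open>(x \<rightarrow> y) \<leadsto> y\<close>, \<open>state_arr\<close> splits the image of
      the arrow; \<open>IS2'_arr\<close> gives the same expression for
      \<open>\<mu> (y \<rightarrow> x)\<close>, so both images are 1.\<close>
    show "((x \<^bold>\<rightarrow> y) \<^bold>\<leadsto> y) \<^bold>\<rightarrow> x \<in> Ker A \<mu>" if "y \<^bold>\<rightarrow> x \<in> Ker A \<mu>"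
      using that IS2'_arr[of y x] state_arr[of "(x \<^bold>\<rightarrow> y) \<^bold>\<leadsto> y" x]
      by (simp add: Ker_def le_arr_sqarr)
    show "((x \<^bold>\<leadsto> y) \<^bold>\<rightarrow> y) \<^bold>\<leadsto> x \<in> Ker A \<mu>" if "y \<^bold>\<leadsto> x \<in> Ker A \<mu>"
      using that IS2'_sqarr[of y x] state_sqarr[of "(x \<^bold>\<leadsto> y) \<^bold>\<rightarrow> y" x]
      by (simp add: Ker_def le_sqarr_arr)
  qed
qed

end

theorem theorem5p15:
  fixes A :: "('a, 'm) pseudo_bck_signature_scheme" and \<mu> :: "'a \<Rightarrow> 'a"
  assumes "pseudo_bck A"
    and "\<mu> \<in> carrier A \<rightarrow> carrier A"
  shows "normal_type_II_state_pseudo_bck A \<mu> \<longleftrightarrow>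
    normal_type_I_state_pseudo_bck A \<mu> \<and> commutative_deductive_system A (Ker A \<mu>)"
  \<comment> \<open>Normality concerns only \<open>Ker A \<mu>\<close> and is the same condition on
    both sides; it also provides the deductive system that \<open>commutative_Ker\<close> starts
    from.\<close>
  unfolding normal_type_I_state_pseudo_bck_def normal_type_II_state_pseudo_bck_def
  using type_II_state_pseudo_bck.type_I type_II_state_pseudo_bck.commutative_Ker
    normal_deductive_system.axioms(1) type_I_state_pseudo_bck.type_II_if_commutative_Ker
  by blast

end
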